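(* Let $f(x)=\tfrac12x'Qx+q'x$ be quadratic with $\mu_f>0$, let $0<\gamma<1/L_f$, and let $\lambda_k=\lambda\in(0,2/(L_h+\mu_h)]$ for all $k$. Let $x^0\in\mathbb{R}^n$ and let the sequences be generated, for $k\ge0$, by $$y^k=\mathrm{prox}_{\gamma f}(x^k),\qquad z^k=\mathrm{prox}_{\gamma g}(2y^k-x^k),\qquad x^{k+1}=x^k+\lambda_k(z^k-y^k).$$ Let $\tilde x\in\tilde X$ and $x_\star=\mathrm{prox}_{\gamma f}(\tilde x)$ (the minimizer of $F$). Then for every $k\ge0$, $$\|y^k-x_\star\|^2\le\frac{\lambda_{\max}(D)}{\lambda_{\min}(D)}\left(1-\frac{2\lambda\mu_hL_h}{\mu_h+L_h}\right)^k\|x^0-\tilde x\|^2.$$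
   Context: $Q\in\mathbb{R}^{n\times n}$ is symmetric positive semidefinite, $q\in\mathbb{R}^n$, $\mu_f=\lambda_{\min}(Q)$, $L_f=\lambda_{\max}(Q)$. Let $g:\mathbb{R}^n\to\mathbb{R}\cup\{+\infty\}$ be proper, closed and convex. Put $F=f+g$ and assume that the set of minimizers of $F$ is nonempty. For $\gamma>0$ and a proper closed convex function $h$, $\mathrm{prox}_{\gamma h}(x)=\arg\min_z\{h(z)+\tfrac{1}{2\gamma}\|z-x\|^2\}$. The set $\tilde X$ is the set of $x\in\mathbb{R}^n$ with $\mathrm{prox}_{\gamma g}(2\,\mathrm{prox}_{\gamma f}(x)-x)=\mathrm{prox}_{\gamma f}(x)$. Define the positive definite matrix $D=\gamma(2(I+\gamma Q)^{-1}-I)^{-1}$, whose extreme eigenvalues are $$\lambda_{\min}(D)=\gamma\frac{1+\gamma\mu_f}{1-\gamma\mu_f},\qquad \lambda_{\max}(D)=\gamma\frac{1+\gamma L_f}{1-\gamma L_f},$$ and the constants $$\mu_h=\lambda_{\min}(D)\,\min\left\{\frac{(1-\gamma\mu_f)\mu_f}{(1+\gamma\mu_f)^2},\frac{(1-\gamma L_f)L_f}{(1+\gamma L_f)^2}\right\},\qquad L_h=\frac{1+\gamma L_f}{1-\gamma L_f}.$$ *)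

theory Defs
  imports "HOL-Analysis.Analysis"
begin

definition eigenvalues :: "real^'n^'n \<Rightarrow> real set" where
  "eigenvalues A = {e. \<exists>v. v \<noteq> 0 \<and> A *v v = e *\<^sub>R v}"

text \<open>Only meaningful if the set of real eigenvalues is finite and nonempty,
  which is the case for symmetric matrices.\<close>

definition lambda_min :: "real^'n^'n \<Rightarrow> real" where
  "lambda_min A = Min (eigenvalues A)"

definition lambda_max :: "real^'n^'n \<Rightarrow> real" where
  "lambda_max A = Max (eigenvalues A)"

definition symmetric_matrix :: "real^'n^'n \<Rightarrow> bool" where
  "symmetric_matrix A \<longleftrightarrow> transpose A = A"

definition pos_semidef :: "real^'n^'n \<Rightarrow> bool" where
  "pos_semidef A \<longleftrightarrow> (\<forall>v. v \<bullet> (A *v v) \<ge> 0)"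

text \<open>The library constant \<open>epigraph\<close> only covers real-valued functions.\<close>

definition ereal_epigraph :: "('a \<Rightarrow> ereal) \<Rightarrow> ('a \<times> real) set" where
  "ereal_epigraph h = {(x, r). h x \<le> ereal r}"

definition proper_fun :: "('a \<Rightarrow> ereal) \<Rightarrow> bool" where
  "proper_fun h \<longleftrightarrow> (\<forall>x. h x \<noteq> -\<infinity>) \<and> (\<exists>x. h x \<noteq> \<infinity>)"

definition closed_fun :: "('a::topological_space \<Rightarrow> ereal) \<Rightarrow> bool" where
  "closed_fun h \<longleftrightarrow> closed (ereal_epigraph h)"

definition convex_fun :: "('a::real_vector \<Rightarrow> ereal) \<Rightarrow> bool" where
  "convex_fun h \<longleftrightarrow> convex (ereal_epigraph h)"

definition minimizers :: "('a \<Rightarrow> ereal) \<Rightarrow> 'a set" where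
  "minimizers h = {x. is_arg_min h (\<lambda>_. True) x}"

text \<open>\<open>arg_min\<close> picks some minimizer; for proper, closed and convex \<open>h\<close> and
  \<open>\<gamma> > 0\<close> the minimizer exists and is unique.\<close>

definition prox :: "real \<Rightarrow> ('a::real_normed_vector \<Rightarrow> ereal) \<Rightarrow> 'a \<Rightarrow> 'a" where
  "prox \<gamma> h x = arg_min (\<lambda>z. h z + ereal (1 / (2 * \<gamma>) * (norm (z - x))\<^sup>2)) (\<lambda>_. True)"

definition DR_fixed ::
  "real \<Rightarrow> ('a::real_normed_vector \<Rightarrow> ereal) \<Rightarrow> ('a \<Rightarrow> ereal) \<Rightarrow> 'a set" where
  "DR_fixed \<gamma> f g = {x. prox \<gamma> g (2 *\<^sub>R prox \<gamma> f x - x) = prox \<gamma> f x}"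

definition DR_iteration ::
  "real \<Rightarrow> (nat \<Rightarrow> real) \<Rightarrow> ('a::real_normed_vector \<Rightarrow> ereal) \<Rightarrow> ('a \<Rightarrow> ereal)
    \<Rightarrow> (nat \<Rightarrow> 'a) \<Rightarrow> (nat \<Rightarrow> 'a) \<Rightarrow> (nat \<Rightarrow> 'a) \<Rightarrow> bool" where
  "DR_iteration \<gamma> lam f g x y z \<longleftrightarrow>
    (\<forall>k. y k = prox \<gamma> f (x k) \<and>
         z k = prox \<gamma> g (2 *\<^sub>R y k - x k) \<and>
         x (Suc k) = x k + lam k *\<^sub>R (z k - y k))"

definition quad_fun :: "real^'n^'n \<Rightarrow> real^'n \<Rightarrow> real^'n \<Rightarrow> ereal" where
  "quad_fun Q q x = ereal (1 / 2 * (x \<bullet> (Q *v x)) + q \<bullet> x)"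

definition DR_D :: "real \<Rightarrow> real^'n^'n \<Rightarrow> real^'n^'n" where
  "DR_D \<gamma> Q = \<gamma> *\<^sub>R matrix_inv (2 *\<^sub>R matrix_inv (mat 1 + \<gamma> *\<^sub>R Q) - mat 1)"

definition DR_mu :: "real \<Rightarrow> real^'n^'n \<Rightarrow> real" where
  "DR_mu \<gamma> Q =
    (let \<mu> = lambda_min Q; L = lambda_max Q in
      lambda_min (DR_D \<gamma> Q) *
        min ((1 - \<gamma> * \<mu>) * \<mu> / (1 + \<gamma> * \<mu>)\<^sup>2) ((1 - \<gamma> * L) * L / (1 + \<gamma> * L)\<^sup>2))"

definition DR_L :: "real \<Rightarrow> real^'n^'n \<Rightarrow> real" where
  "DR_L \<gamma> Q = (let L = lambda_max Q in (1 + \<gamma> * L) / (1 - \<gamma> * L))"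

end

theory Submission
  imports Defs
begin

text \<open>
  Write \<open>P = (I + \<gamma> Q)\<^sup>-\<^sup>1\<close> and \<open>M = 2 P - I = \<gamma> D\<^sup>-\<^sup>1\<close>. The proof measures the distance of \<open>x\<^sup>k\<close> to
  the fixed point in the norm \<open>v \<mapsto> sqrt (v \<bullet> M v)\<close>, because in this geometry the iteration is a
  gradient method with step \<open>\<lambda>\<close> for a strongly convex function with Lipschitz gradient (the
  Douglas--Rachford envelope, rescaled by \<open>D\<close>).

  Let \<open>\<delta>\<close> be the difference of two iterates, \<open>d\<close> the difference of the corresponding \<open>z\<close>, and \<open>T\<close> the
  difference of the corresponding \<open>y - z\<close>. Since \<open>prox\<^sub>\<gamma>\<^sub>f\<close> is affine with linear part \<open>P\<close>,
  \<open>T = P \<delta> - d = \<delta> / 2 - r\<close> with \<open>r = d - M \<delta> / 2\<close>. Firm nonexpansiveness of \<open>prox\<^sub>\<gamma>\<^sub>g\<close> says exactly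
  that \<open>d\<close> lies in the ball with diameter from \<open>0\<close> to \<open>M \<delta>\<close>, that is, \<open>|r| \<le> |M \<delta>| / 2\<close>. With
  \<open>X = \<lambda>\<^sub>m\<^sub>a\<^sub>x(M)\<close>, comparing \<open>M\<close> with \<open>X\<close> twice turns this into
  \<open>r \<bullet> M r \<le> X\<^sup>2 / 4 (\<delta> \<bullet> M \<delta>)\<close>: in the \<open>M\<close>-norm \<open>T\<close> lies in the ball with diameter from
  \<open>(1 - X) / 2 \<delta>\<close> to \<open>(1 + X) / 2 \<delta>\<close>. This is the inequality satisfied by differences of gradients of
  a function with strong convexity constant \<open>(1 - X) / 2\<close> and Lipschitz constant \<open>(1 + X) / 2\<close>, and it
  survives lowering the first constant to \<open>\<mu>\<^sub>h\<close> and raising the second to \<open>L\<^sub>h\<close>. The usual estimate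
  for a gradient step then gives the contraction factor (\<open>DR_step_contraction\<close>).

  Passing between the \<open>M\<close>-norm and the Euclidean norm costs the factor
  \<open>\<lambda>\<^sub>m\<^sub>a\<^sub>x(M) / \<lambda>\<^sub>m\<^sub>i\<^sub>n(M) = \<lambda>\<^sub>m\<^sub>a\<^sub>x(D) / \<lambda>\<^sub>m\<^sub>i\<^sub>n(D)\<close>, and passing from \<open>x\<^sup>k\<close> to \<open>y\<^sup>k\<close> costs nothing because
  \<open>P\<close> is nonexpansive (\<open>resolvent_nonexpansive\<close>).

  That \<open>prox\<^sub>\<gamma>\<^sub>g\<close> is attained follows from the existence of a minimizer of \<open>F\<close>: its optimality
  condition is a subgradient of \<open>g\<close> (\<open>subgradient_of_minimizer\<close>), hence an affine minorant, which
  makes the proximal objective coercive (\<open>subgradient_prox\<close>). At a fixed point the subgradient of \<open>g\<close>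
  delivered by \<open>prox\<^sub>\<gamma>\<^sub>g\<close> is the negative of the gradient of \<open>f\<close>, so strong convexity makes \<open>x\<^sub>\<star>\<close>
  the unique minimizer.
\<close>

section \<open>Extreme eigenvalues of symmetric matrices\<close>

lemma symmetric_matrix_inner:
  fixes A :: "real^'n^'n"
  assumes "symmetric_matrix A"
  shows "u \<bullet> (A *v w) = (A *v u) \<bullet> w"
  using assms unfolding symmetric_matrix_def
  by (metis dot_lmul_matrix transpose_matrix_vector)

lemma symmetric_matrix_affine:
  fixes A :: "real^'n^'n"
  assumes "symmetric_matrix A"
  shows "symmetric_matrix (c *\<^sub>R A + d *\<^sub>R mat 1)"
proof -
  have "A $ j $ i = A $ i $ j" for i j
    using arg_cong[OF assms[unfolded symmetric_matrix_def], of "\<lambda>B. B $ i $ j"]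
    by (simp add: transpose_def)
  then show ?thesis
    unfolding symmetric_matrix_def transpose_def mat_def by (auto simp: vec_eq_iff)
qed

lemma affine_matrix_vector_mult:
  fixes A :: "real^'n^'n"
  shows "(c *\<^sub>R A + d *\<^sub>R mat 1) *v v = c *\<^sub>R (A *v v) + d *\<^sub>R v"
  by (simp add: matrix_vector_mult_add_rdistrib flip: scaleR_matrix_vector_assoc)

text \<open>
  The quadratic polynomial \<open>t \<mapsto> (t u + w) \<bullet> A (t u + w)\<close> is nonnegative, so its discriminant is not
  positive.
\<close>

lemma pos_semidef_Cauchy_Schwarz:
  fixes A :: "real^'n^'n"
  assumes "symmetric_matrix A" "pos_semidef A"
  shows "(u \<bullet> (A *v w))\<^sup>2 \<le> (u \<bullet> (A *v u)) * (w \<bullet> (A *v w))"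
proof -
  define \<alpha> \<beta> \<omega> where "\<alpha> = u \<bullet> (A *v u)" and "\<beta> = u \<bullet> (A *v w)" and "\<omega> = w \<bullet> (A *v w)"
  have nonneg: "0 \<le> \<alpha> * t\<^sup>2 + 2 * \<beta> * t + \<omega>" for t
  proof -
    have "w \<bullet> (A *v u) = \<beta>"
      unfolding \<beta>_def using symmetric_matrix_inner[OF assms(1), of w u] by (simp add: inner_commute)
    then have "(t *\<^sub>R u + w) \<bullet> (A *v (t *\<^sub>R u + w)) = \<alpha> * t\<^sup>2 + 2 * \<beta> * t + \<omega>"
      unfolding \<alpha>_def \<beta>_def \<omega>_def
      by (simp add: matrix_vector_right_distrib matrix_vector_mult_scaleR inner_simps
          power2_eq_square algebra_simps)
    then show ?thesis using assms(2) unfolding pos_semidef_def by metis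
  qed
  have "\<beta>\<^sup>2 \<le> \<alpha> * \<omega>"
  proof (cases "\<alpha> = 0")
    case True
    have "\<beta> = 0"
    proof (rule ccontr)
      assume "\<beta> \<noteq> 0"
      then show False using nonneg[of "- (\<omega> + 1) / (2 * \<beta>)"] True by simp
    qed
    then show ?thesis using True by simp
  next
    case False
    then have "\<alpha> > 0"
      using assms(2) unfolding pos_semidef_def \<alpha>_def by (simp add: less_le)
    moreover have "\<alpha> * (- \<beta> / \<alpha>)\<^sup>2 + 2 * \<beta> * (- \<beta> / \<alpha>) + \<omega> = \<omega> - \<beta>\<^sup>2 / \<alpha>"
      using False by (simp add: power2_eq_square field_simps)
    ultimately show ?thesis
      using nonneg[of "- \<beta> / \<alpha>"] by (simp add: pos_divide_le_eq mult.commute)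
  qed
  then show ?thesis by (simp add: \<alpha>_def \<beta>_def \<omega>_def)
qed

lemma pos_semidef_null_vector:
  fixes A :: "real^'n^'n"
  assumes "symmetric_matrix A" "pos_semidef A" "v \<bullet> (A *v v) = 0"
  shows "A *v v = 0"
  using pos_semidef_Cauchy_Schwarz[OF assms(1,2), of "A *v v" v] assms(3) by simp

lemma eigenvalues_affine:
  fixes A :: "real^'n^'n"
  assumes "c \<noteq> 0"
  shows "eigenvalues (c *\<^sub>R A + d *\<^sub>R mat 1) = (\<lambda>e. c * e + d) ` eigenvalues A"
proof (intro equalityI subsetI)
  fix e assume "e \<in> eigenvalues (c *\<^sub>R A + d *\<^sub>R mat 1)"
  then obtain v where v: "v \<noteq> 0" "c *\<^sub>R (A *v v) + d *\<^sub>R v = e *\<^sub>R v"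
    unfolding eigenvalues_def affine_matrix_vector_mult by auto
  then have "c *\<^sub>R (A *v v) = (e - d) *\<^sub>R v"
    by (simp add: algebra_simps)
  then have "(1 / c) *\<^sub>R c *\<^sub>R (A *v v) = (1 / c) *\<^sub>R (e - d) *\<^sub>R v" by simp
  then have "A *v v = ((e - d) / c) *\<^sub>R v" using assms by simp
  then have "(e - d) / c \<in> eigenvalues A" using v(1) unfolding eigenvalues_def by auto
  moreover have "e = c * ((e - d) / c) + d" using assms by simp
  ultimately show "e \<in> (\<lambda>e. c * e + d) ` eigenvalues A" by (rule rev_image_eqI)
next
  fix e assume "e \<in> (\<lambda>e. c * e + d) ` eigenvalues A"
  then obtain s v where "e = c * s + d" "v \<noteq> 0" "A *v v = s *\<^sub>R v"
    unfolding eigenvalues_def by auto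
  then show "e \<in> eigenvalues (c *\<^sub>R A + d *\<^sub>R mat 1)"
    unfolding eigenvalues_def affine_matrix_vector_mult by (auto simp: algebra_simps intro!: exI[of _ v])
qed

lemma invertible_iff_eigenvalues:
  fixes A :: "real^'n^'n"
  shows "invertible A \<longleftrightarrow> 0 \<notin> eigenvalues A"
  unfolding invertible_left_inverse matrix_left_invertible_ker eigenvalues_def by auto

lemma matrix_inv_mult:
  fixes A :: "real^'n^'n"
  assumes "invertible A"
  shows matrix_inv_right: "A ** matrix_inv A = mat 1"
    and matrix_inv_left: "matrix_inv A ** A = mat 1"
  using someI_ex[OF assms[unfolded invertible_def]] unfolding matrix_inv_def by auto

lemma symmetric_matrix_inv:
  fixes A :: "real^'n^'n"
  assumes "symmetric_matrix A" "invertible A"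
  shows "symmetric_matrix (matrix_inv A)"
proof -
  let ?B = "matrix_inv A"
  have "transpose ?B ** A = mat 1"
    using matrix_inv_right[OF assms(2)] assms(1) unfolding symmetric_matrix_def
    by (metis matrix_transpose_mul transpose_mat)
  then have "transpose ?B = ?B"
    using matrix_inv_right[OF assms(2)]
    by (metis matrix_mul_assoc matrix_mul_lid matrix_mul_rid)
  then show ?thesis unfolding symmetric_matrix_def .
qed

text \<open>
  Both inclusions are the same fact, that a left inverse inverts eigenvalues, applied to \<open>A\<close> and to its
  inverse.
\<close>

lemma eigenvalues_matrix_inv:
  fixes A :: "real^'n^'n"
  assumes "invertible A"
  shows "eigenvalues (matrix_inv A) = inverse ` eigenvalues A"
proof -
  have inverse_eigenvalue: "inverse e \<in> eigenvalues C"
    if inv: "C ** B = mat 1" and eig: "e \<in> eigenvalues B" for e and B C :: "real^'n^'n"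
  proof -
    obtain v where v: "v \<noteq> 0" "B *v v = e *\<^sub>R v" using eig unfolding eigenvalues_def by auto
    have "v = C *v (B *v v)"
      by (simp add: matrix_vector_mul_assoc inv)
    also have "\<dots> = e *\<^sub>R (C *v v)" by (simp add: v(2) matrix_vector_mult_scaleR)
    finally have eq: "v = e *\<^sub>R (C *v v)" .
    then have "e \<noteq> 0" using v(1) by auto
    then have "C *v v = inverse e *\<^sub>R v" by (subst eq) simp
    then show ?thesis using v(1) unfolding eigenvalues_def by auto
  qed
  show ?thesis
  proof (intro equalityI subsetI)
    fix e assume "e \<in> eigenvalues (matrix_inv A)"
    then show "e \<in> inverse ` eigenvalues A"
      using inverse_eigenvalue[OF matrix_inv_right[OF assms]] by (intro image_eqI[of _ _ "inverse e"]) auto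
  next
    fix e assume "e \<in> inverse ` eigenvalues A"
    then show "e \<in> eigenvalues (matrix_inv A)"
      using inverse_eigenvalue[OF matrix_inv_left[OF assms]] by auto
  qed
qed

text \<open>
  Eigenvectors for distinct eigenvalues of a symmetric matrix are orthogonal, hence independent, and
  an independent family in a finite-dimensional space is finite.
\<close>

lemma finite_eigenvalues:
  fixes A :: "real^'n^'n"
  assumes "symmetric_matrix A"
  shows "finite (eigenvalues A)"
proof -
  define ev where "ev e = (SOME v. v \<noteq> 0 \<and> A *v v = e *\<^sub>R v)" for e
  have ev: "ev e \<noteq> 0" "A *v ev e = e *\<^sub>R ev e" if "e \<in> eigenvalues A" for e
    using someI_ex[of "\<lambda>v. v \<noteq> 0 \<and> A *v v = e *\<^sub>R v"] that
    unfolding eigenvalues_def ev_def by auto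
  have orth: "ev d \<bullet> ev e = 0" if "d \<in> eigenvalues A" "e \<in> eigenvalues A" "d \<noteq> e" for d e
    using symmetric_matrix_inner[OF assms, of "ev d" "ev e"] ev[OF that(1)] ev[OF that(2)] that(3)
    by simp
  have "inj_on ev (eigenvalues A)"
    using orth ev by (metis inj_onI inner_eq_zero_iff)
  moreover have "independent (ev ` eigenvalues A)"
  proof (rule pairwise_orthogonal_independent)
    show "pairwise orthogonal (ev ` eigenvalues A)"
      using orth unfolding pairwise_def orthogonal_def by blast
    show "0 \<notin> ev ` eigenvalues A" using ev by force
  qed
  then have "finite (ev ` eigenvalues A)" by (rule independent_imp_finite)
  ultimately show ?thesis by (simp add: finite_image_iff)
qed

text \<open>
  Let \<open>v\<^sub>0\<close> maximize the quadratic form over the unit sphere, with value \<open>e\<close>. Then \<open>e I - A\<close> is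
  positive semidefinite and its form vanishes at \<open>v\<^sub>0\<close>, so it annihilates \<open>v\<^sub>0\<close>; that is, \<open>v\<^sub>0\<close> is an
  eigenvector for \<open>e\<close>.
\<close>

lemma symmetric_matrix_top_eigenvalue:
  fixes A :: "real^'n^'n"
  assumes "symmetric_matrix A"
  obtains e where "e \<in> eigenvalues A" "\<And>v. v \<bullet> (A *v v) \<le> e * (v \<bullet> v)"
proof -
  have "compact (sphere (0::real^'n) 1)" by simp
  moreover have "sphere (0::real^'n) 1 \<noteq> {}" by simp
  moreover have "continuous_on (sphere (0::real^'n) 1) (\<lambda>v. v \<bullet> (A *v v))"
    by (intro continuous_intros linear_continuous_on_compose[OF continuous_on_id])
       (rule matrix_vector_mul_linear)
  ultimately obtain v0 where v0: "norm v0 = 1"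
    and top: "\<And>v. norm v = 1 \<Longrightarrow> v \<bullet> (A *v v) \<le> v0 \<bullet> (A *v v0)"
    using continuous_attains_sup[of "sphere 0 1" "\<lambda>v. v \<bullet> (A *v v)"] by fastforce
  define e where "e = v0 \<bullet> (A *v v0)"
  have bound: "v \<bullet> (A *v v) \<le> e * (v \<bullet> v)" for v
  proof (cases "v = 0")
    case False
    define n where "n = norm v"
    then have n: "n > 0" using False by simp
    have "norm ((1 / n) *\<^sub>R v) = 1" using n by (simp add: n_def)
    from top[OF this] have "(1 / n) * ((1 / n) * (v \<bullet> (A *v v))) \<le> e"
      by (simp add: matrix_vector_mult_scaleR e_def)
    then have "v \<bullet> (A *v v) \<le> e * (n * n)" using n by (simp add: field_simps)
    then show ?thesis by (simp add: n_def power2_norm_eq_inner flip: power2_eq_square)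
  qed simp
  let ?B = "(-1) *\<^sub>R A + e *\<^sub>R mat 1"
  have "?B *v v0 = 0"
  proof (rule pos_semidef_null_vector)
    show "symmetric_matrix ?B" by (rule symmetric_matrix_affine[OF assms])
    show "pos_semidef ?B"
      unfolding pos_semidef_def affine_matrix_vector_mult
      using bound by (simp add: inner_simps)
    have "v0 \<bullet> v0 = 1" using v0 by (simp add: norm_eq_1)
    then show "v0 \<bullet> (?B *v v0) = 0"
      unfolding affine_matrix_vector_mult by (simp add: inner_simps e_def)
  qed
  then have "A *v v0 = e *\<^sub>R v0" unfolding affine_matrix_vector_mult by simp
  moreover have "v0 \<noteq> 0" using v0 by auto
  ultimately have "e \<in> eigenvalues A" unfolding eigenvalues_def by auto
  then show ?thesis using bound by (rule that)
qed

text \<open>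
  The lower bound is the upper bound for \<open>- A\<close>.
\<close>

lemma Rayleigh_quotient_bounds:
  fixes A :: "real^'n^'n"
  assumes "symmetric_matrix A"
  shows eigenvalues_nonempty: "eigenvalues A \<noteq> {}"
    and lambda_max_bound: "v \<bullet> (A *v v) \<le> lambda_max A * (v \<bullet> v)"
    and lambda_min_bound: "lambda_min A * (v \<bullet> v) \<le> v \<bullet> (A *v v)"
proof -
  note fin = finite_eigenvalues[OF assms]
  obtain e where e: "e \<in> eigenvalues A" "\<And>v. v \<bullet> (A *v v) \<le> e * (v \<bullet> v)"
    using symmetric_matrix_top_eigenvalue[OF assms] by blast
  then show "eigenvalues A \<noteq> {}" by auto
  have "e \<le> lambda_max A" unfolding lambda_max_def using fin e(1) by simp
  then show "v \<bullet> (A *v v) \<le> lambda_max A * (v \<bullet> v)"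
    using e(2)[of v] mult_right_mono[of e "lambda_max A" "v \<bullet> v"] by simp
  let ?B = "(-1) *\<^sub>R A + 0 *\<^sub>R mat 1"
  obtain d where d: "d \<in> eigenvalues ?B" "\<And>v. v \<bullet> (?B *v v) \<le> d * (v \<bullet> v)"
    using symmetric_matrix_top_eigenvalue[OF symmetric_matrix_affine[OF assms, of "-1" 0]] by blast
  have "- d \<in> eigenvalues A"
    using d(1) by (subst (asm) eigenvalues_affine) auto
  then have "lambda_min A \<le> - d" unfolding lambda_min_def using fin by simp
  moreover have "- d * (v \<bullet> v) \<le> v \<bullet> (A *v v)"
    using d(2)[of v] unfolding affine_matrix_vector_mult by simp
  ultimately show "lambda_min A * (v \<bullet> v) \<le> v \<bullet> (A *v v)"
    using mult_right_mono[of "lambda_min A" "- d" "v \<bullet> v"] by simp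
qed

lemma lambda_antimono:
  fixes A :: "real^'n^'n" and B :: "real^'m^'m"
  assumes "symmetric_matrix A" and "eigenvalues B = \<phi> ` eigenvalues A"
    and "\<And>s t. s \<in> eigenvalues A \<Longrightarrow> t \<in> eigenvalues A \<Longrightarrow> s \<le> t \<Longrightarrow> \<phi> t \<le> \<phi> s"
  shows "lambda_min B = \<phi> (lambda_max A)" and "lambda_max B = \<phi> (lambda_min A)"
proof -
  note fin = finite_eigenvalues[OF assms(1)] and ne = eigenvalues_nonempty[OF assms(1)]
  have "Min (eigenvalues A) \<in> eigenvalues A" "Max (eigenvalues A) \<in> eigenvalues A"
    using fin ne by auto
  moreover have "Min (eigenvalues A) \<le> s" "s \<le> Max (eigenvalues A)" if "s \<in> eigenvalues A" for s
    using fin that by auto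
  ultimately show "lambda_min B = \<phi> (lambda_max A)" "lambda_max B = \<phi> (lambda_min A)"
    unfolding lambda_min_def lambda_max_def assms(2)
    using assms(3) by (intro Min_eqI Max_eqI; use fin in force)+
qed

lemma eigenvalue_bounds:
  assumes "symmetric_matrix A" "s \<in> eigenvalues A"
  shows "lambda_min A \<le> s" "s \<le> lambda_max A"
  using finite_eigenvalues[OF assms(1)] assms(2) unfolding lambda_min_def lambda_max_def by auto

lemma lambda_min_le_max:
  assumes "symmetric_matrix A"
  shows "lambda_min A \<le> lambda_max A"
  using eigenvalues_nonempty[OF assms] eigenvalue_bounds[OF assms] by (meson all_not_in_conv order_trans)

section \<open>Subgradients and proximal maps\<close>

text \<open>
  Finiteness of \<open>h x\<close> is part of the notion: without it every vector would be a subgradient at a point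
  where \<open>h\<close> is \<open>-\<infinity>\<close>.
\<close>

definition subgradient :: "('a::real_inner \<Rightarrow> ereal) \<Rightarrow> 'a \<Rightarrow> 'a \<Rightarrow> bool" where
  "subgradient h x s \<longleftrightarrow> \<bar>h x\<bar> \<noteq> \<infinity> \<and> (\<forall>z. h x + ereal (s \<bullet> (z - x)) \<le> h z)"

text \<open>
  First-order optimality for a sum \<open>\<phi> + g\<close>, where the quadratic upper bound makes \<open>p\<close> the gradient of
  \<open>\<phi>\<close> at \<open>x\<close>. Moving from \<open>x\<close> towards \<open>z\<close> by a fraction \<open>t\<close>, convexity bounds the change of \<open>g\<close> by
  \<open>t (g z - g x)\<close>, while \<open>\<phi>\<close> changes by \<open>t p \<bullet> (z - x)\<close> up to an error of order \<open>t\<^sup>2\<close>; dividing by \<open>t\<close>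
  and letting it tend to zero gives the subgradient inequality.
\<close>

lemma subgradient_of_minimizer:
  fixes g :: "'a::real_inner \<Rightarrow> ereal" and \<phi> :: "'a \<Rightarrow> real"
  assumes "proper_fun g" "convex_fun g"
    and min: "is_arg_min (\<lambda>v. ereal (\<phi> v) + g v) (\<lambda>_. True) x"
    and upper: "\<And>v. \<phi> (x + v) \<le> \<phi> x + p \<bullet> v + C * (v \<bullet> v)"
  shows "subgradient g x (- p)"
proof -
  have notm: "g v \<noteq> -\<infinity>" for v using assms(1) unfolding proper_fun_def by auto
  have le: "ereal (\<phi> x) + g x \<le> ereal (\<phi> v) + g v" for v
    using min unfolding is_arg_min_linorder by auto
  obtain v0 where "g v0 \<noteq> \<infinity>" using assms(1) unfolding proper_fun_def by auto
  then have "g x \<noteq> \<infinity>" using le[of v0] notm[of v0] by auto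
  then obtain a where a: "g x = ereal a" using notm[of x] by (cases "g x") auto
  have "ereal a + ereal (- p \<bullet> (z - x)) \<le> g z" for z
  proof (cases "g z")
    case (real b)
    define v where "v = z - x"
    have slope: "- (p \<bullet> v) - t * (C * (v \<bullet> v)) \<le> b - a" if t: "0 < t" "t < 1" for t
    proof -
      have "(1 - t) *\<^sub>R (x, a) + t *\<^sub>R (z, b) \<in> ereal_epigraph g"
        using assms(2) t a real unfolding convex_fun_def
        by (intro convexD) (auto simp: ereal_epigraph_def)
      moreover have "(1 - t) *\<^sub>R x + t *\<^sub>R z = x + t *\<^sub>R v"
        by (simp add: v_def algebra_simps)
      ultimately have "g (x + t *\<^sub>R v) \<le> ereal ((1 - t) * a + t * b)"
        unfolding ereal_epigraph_def by simp
      then have "ereal (\<phi> x) + g x \<le> ereal (\<phi> (x + t *\<^sub>R v)) + ereal ((1 - t) * a + t * b)"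
        using le[of "x + t *\<^sub>R v"] by (meson add_left_mono order_trans)
      then have "\<phi> x + a \<le> \<phi> (x + t *\<^sub>R v) + ((1 - t) * a + t * b)" using a by simp
      also have "\<dots> \<le> \<phi> x + t * (p \<bullet> v) + C * (t * t * (v \<bullet> v)) + ((1 - t) * a + t * b)"
        using upper[of "t *\<^sub>R v"] by (simp add: algebra_simps)
      finally have "t * (- (p \<bullet> v) - t * (C * (v \<bullet> v))) \<le> t * (b - a)"
        by (simp add: algebra_simps)
      then show ?thesis using t by simp
    qed
    have "((\<lambda>t. - (p \<bullet> v) - t * (C * (v \<bullet> v))) \<longlongrightarrow> - (p \<bullet> v) - 0 * (C * (v \<bullet> v))) (at_right 0)"
      by (intro tendsto_intros)
    moreover have "eventually (\<lambda>t. - (p \<bullet> v) - t * (C * (v \<bullet> v)) \<le> b - a) (at_right 0)"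
      using eventually_at_right_real[OF zero_less_one] by (rule eventually_mono) (auto intro: slope)
    ultimately have "- (p \<bullet> v) - 0 * (C * (v \<bullet> v)) \<le> b - a"
      by (intro tendsto_upperbound) auto
    then show ?thesis using real by (simp add: v_def)
  qed (use notm in auto)
  then show ?thesis unfolding subgradient_def a by simp
qed

text \<open>
  The converse of first-order optimality: the linear terms of the two lower bounds cancel, and the
  strictly positive quadratic term excludes any second minimizer.
\<close>

lemma unique_minimizer_of_subgradient:
  fixes h :: "'a::real_inner \<Rightarrow> ereal" and \<phi> :: "'a \<Rightarrow> real"
  assumes sub: "subgradient h x (- p)"
    and lower: "\<And>v. \<phi> x + p \<bullet> v + c * (v \<bullet> v) \<le> \<phi> (x + v)"
    and "c > 0"
  shows "is_arg_min (\<lambda>v. ereal (\<phi> v) + h v) (\<lambda>_. True) w \<longleftrightarrow> w = x"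
proof -
  obtain a where a: "h x = ereal a" using sub unfolding subgradient_def by (cases "h x") auto
  have gap: "ereal (\<phi> x + c * ((z - x) \<bullet> (z - x))) + h x \<le> ereal (\<phi> z) + h z" for z
  proof -
    have "ereal (a - p \<bullet> (z - x)) \<le> h z"
      using sub a unfolding subgradient_def by (simp add: inner_minus_left)
    then have "ereal (\<phi> z) + ereal (a - p \<bullet> (z - x)) \<le> ereal (\<phi> z) + h z"
      by (rule add_left_mono)
    moreover have "\<phi> x + c * ((z - x) \<bullet> (z - x)) + a \<le> \<phi> z + (a - p \<bullet> (z - x))"
      using lower[of "z - x"] by simp
    ultimately show ?thesis unfolding a by (metis ereal_less_eq(3) order_trans plus_ereal.simps(1))
  qed
  have "ereal (\<phi> x) + h x \<le> ereal (\<phi> z) + h z" for z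
  proof -
    have "ereal (\<phi> x) + h x \<le> ereal (\<phi> x + c * ((z - x) \<bullet> (z - x))) + h x"
      unfolding a using \<open>c > 0\<close> by simp
    then show ?thesis using gap[of z] by (rule order_trans)
  qed
  moreover have "w = x" if "ereal (\<phi> w) + h w \<le> ereal (\<phi> x) + h x"
  proof -
    have "ereal (\<phi> x + c * ((w - x) \<bullet> (w - x))) + h x \<le> ereal (\<phi> x) + h x"
      using gap[of w] that by (rule order_trans)
    then have "c * ((w - x) \<bullet> (w - x)) \<le> 0" unfolding a by simp
    then have "(w - x) \<bullet> (w - x) \<le> 0" using \<open>c > 0\<close> by (simp add: mult_le_0_iff)
    then show ?thesis by (metis inner_ge_zero inner_eq_zero_iff order_antisym right_minus_eq)
  qed
  ultimately show ?thesis unfolding is_arg_min_linorder by blast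
qed

lemma proximal_term_expansion:
  fixes w v u :: "'a::real_inner"
  shows "1 / (2 * \<gamma>) * (norm (w + v - u))\<^sup>2 =
    1 / (2 * \<gamma>) * (norm (w - u))\<^sup>2 + ((1 / \<gamma>) *\<^sub>R (w - u)) \<bullet> v + 1 / (2 * \<gamma>) * (v \<bullet> v)"
proof -
  have "w + v - u = (w - u) + v" by simp
  then show ?thesis unfolding power2_norm_eq_inner
    by (simp only: inner_add_left inner_add_right inner_scaleR_left inner_commute[of v "w - u"])
       (simp add: field_simps add_divide_distrib)
qed

lemma prox_eqI:
  fixes h :: "'a::real_inner \<Rightarrow> ereal"
  assumes "\<gamma> > 0" and sub: "subgradient h w ((1 / \<gamma>) *\<^sub>R (u - w))"
  shows "prox \<gamma> h u = w"
proof -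
  let ?\<phi> = "\<lambda>v. 1 / (2 * \<gamma>) * (norm (v - u))\<^sup>2"
  have "subgradient h w (- ((1 / \<gamma>) *\<^sub>R (w - u)))"
    using sub by (simp add: algebra_simps)
  then have "is_arg_min (\<lambda>v. ereal (?\<phi> v) + h v) (\<lambda>_. True) v \<longleftrightarrow> v = w" for v
    by (rule unique_minimizer_of_subgradient[where c = "1 / (2 * \<gamma>)"])
       (use assms(1) proximal_term_expansion[of \<gamma> w _ u] in auto)
  then show ?thesis
    unfolding prox_def arg_min_def add.commute[of "h _"] by (intro some_equality) auto
qed

text \<open>
  Besides the optimality condition of the proximal problem, this contains the existence of its
  solution, since \<open>prox\<close> is an arbitrary point when no minimizer exists. The subgradient at \<open>x0\<close>
  provides an affine minorant of \<open>g\<close>. The part \<open>E\<close> of the epigraph on which the proximal objective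
  does not exceed its value at \<open>x0\<close> is therefore compact, and the objective is continuous on it when
  the value of \<open>g\<close> is replaced by the second coordinate. Working in the epigraph lets closedness of
  \<open>g\<close> be used directly, in place of lower semicontinuity.
\<close>

lemma subgradient_prox:
  fixes g :: "'a::euclidean_space \<Rightarrow> ereal"
  assumes "proper_fun g" "closed_fun g" "convex_fun g" "\<gamma> > 0"
    and sub: "subgradient g x0 s"
  shows "subgradient g (prox \<gamma> g u) ((1 / \<gamma>) *\<^sub>R (u - prox \<gamma> g u))"
proof -
  let ?\<phi> = "\<lambda>v. 1 / (2 * \<gamma>) * (norm (v - u))\<^sup>2"
  obtain a where a: "g x0 = ereal a" using sub unfolding subgradient_def by (cases "g x0") auto
  define c0 where "c0 = a + ?\<phi> x0"
  define E where "E = {p \<in> ereal_epigraph g. snd p + ?\<phi> (fst p) \<le> c0}"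
  define b where "b = a + s \<bullet> (u - x0)"
  \<comment> \<open>A real \<open>n \<ge> 1\<close> with \<open>n\<^sup>2 / (2 \<gamma>) \<le> c\<^sub>0 - b + |s| n\<close> is at most \<open>R\<close>; the maximum with 1 allows
    to estimate \<open>c\<^sub>0 - b\<close> by \<open>n |c\<^sub>0 - b|\<close>.\<close>
  define R where "R = max 1 (2 * \<gamma> * (\<bar>c0 - b\<bar> + norm s))"
  have minorant: "b - norm s * norm (v - u) \<le> r" if "(v, r) \<in> ereal_epigraph g" for v r
  proof -
    have "ereal (a + s \<bullet> (v - x0)) \<le> g v" using sub a unfolding subgradient_def by simp
    also have "\<dots> \<le> ereal r" using that unfolding ereal_epigraph_def by simp
    finally have "a + s \<bullet> (v - x0) \<le> r" by simp
    moreover have "a + s \<bullet> (v - x0) = b + s \<bullet> (v - u)" by (simp add: b_def algebra_simps)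
    moreover have "- (norm s * norm (v - u)) \<le> s \<bullet> (v - u)"
      using Cauchy_Schwarz_ineq2[of s "v - u"] by linarith
    ultimately show ?thesis by linarith
  qed
  have inside: "norm (v - u) \<le> R \<and> b - norm s * R \<le> r \<and> r \<le> c0" if "(v, r) \<in> E" for v r
  proof -
    define n where "n = norm (v - u)"
    have epi: "(v, r) \<in> ereal_epigraph g" and le: "r + 1 / (2 * \<gamma>) * n\<^sup>2 \<le> c0"
      using that unfolding E_def n_def by auto
    have quadratic: "1 / (2 * \<gamma>) * n\<^sup>2 \<le> c0 - b + norm s * n"
      using minorant[OF epi] le unfolding n_def by linarith
    have "n \<le> R"
    proof (rule ccontr)
      assume "\<not> n \<le> R"
      then have n: "n > 1" "2 * \<gamma> * (\<bar>c0 - b\<bar> + norm s) < n" unfolding R_def by auto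
      have "n * n \<le> 2 * \<gamma> * (c0 - b + norm s * n)"
        using quadratic assms(4) by (simp add: field_simps power2_eq_square)
      moreover have "1 * \<bar>c0 - b\<bar> \<le> n * \<bar>c0 - b\<bar>" using n by (intro mult_right_mono) auto
      then have "c0 - b + norm s * n \<le> n * (\<bar>c0 - b\<bar> + norm s)"
        by (simp add: algebra_simps)
      ultimately have "n * n \<le> 2 * \<gamma> * (n * (\<bar>c0 - b\<bar> + norm s))"
        using assms(4) by (meson mult_left_mono order_trans less_imp_le mult_pos_pos zero_less_numeral)
      then have "n * n \<le> n * (2 * \<gamma> * (\<bar>c0 - b\<bar> + norm s))" by (simp add: algebra_simps)
      then show False using n by simp
    qed
    moreover have "r \<le> c0" using le assms(4) by (smt (verit) divide_nonneg_pos zero_le_power2 mult_nonneg_nonneg zero_less_mult_iff)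
    moreover have "b - norm s * R \<le> r"
      using minorant[OF epi] mult_left_mono[OF \<open>n \<le> R\<close> norm_ge_zero[of s]] unfolding n_def by linarith
    ultimately show ?thesis unfolding n_def by simp
  qed
  have "compact E"
  proof -
    have "E \<subseteq> cball u R \<times> {b - norm s * R..c0}"
      using inside by (auto simp: dist_norm norm_minus_commute)
    then have "bounded E"
      by (rule bounded_subset[rotated]) (intro bounded_Times bounded_cball bounded_closed_interval)
    moreover have "closed E"
    proof -
      have "E = ereal_epigraph g \<inter> {p. snd p + ?\<phi> (fst p) \<le> c0}" unfolding E_def by auto
      moreover have "closed {p :: 'a \<times> real. snd p + ?\<phi> (fst p) \<le> c0}"
        by (intro closed_Collect_le continuous_intros)
      ultimately show ?thesis using assms(2) unfolding closed_fun_def by (simp add: closed_Int)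
    qed
    ultimately show ?thesis by (simp add: compact_eq_bounded_closed)
  qed
  moreover have start: "(x0, a) \<in> E"
    unfolding E_def c0_def using a by (simp add: ereal_epigraph_def)
  moreover have "continuous_on E (\<lambda>p. snd p + ?\<phi> (fst p))"
    by (intro continuous_intros)
  ultimately obtain w r where wr: "(w, r) \<in> E"
    and best: "\<And>v t. (v, t) \<in> E \<Longrightarrow> r + ?\<phi> w \<le> t + ?\<phi> v"
    using continuous_attains_inf[of E "\<lambda>p. snd p + ?\<phi> (fst p)"] by fastforce
  have "ereal (?\<phi> w) + g w \<le> ereal (?\<phi> v) + g v" for v
  proof -
    have "ereal (?\<phi> w) + g w \<le> ereal (?\<phi> w) + ereal r"
      using wr unfolding E_def ereal_epigraph_def by (intro add_left_mono) auto
    also have "\<dots> \<le> ereal (?\<phi> v) + g v"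
    proof (cases "g v")
      case (real t)
      have "r + ?\<phi> w \<le> t + ?\<phi> v"
      proof (cases "(v, t) \<in> E")
        case False
        then have "c0 \<le> t + ?\<phi> v" using real unfolding E_def ereal_epigraph_def by auto
        moreover have "r + ?\<phi> w \<le> c0" using wr unfolding E_def by auto
        ultimately show ?thesis by linarith
      qed (rule best)
      then show ?thesis using real by simp
    qed (use assms(1) in \<open>auto simp: proper_fun_def\<close>)
    finally show ?thesis .
  qed
  then have "is_arg_min (\<lambda>v. ereal (?\<phi> v) + g v) (\<lambda>_. True) w"
    unfolding is_arg_min_linorder by blast
  then have "subgradient g w (- ((1 / \<gamma>) *\<^sub>R (w - u)))"
    by (rule subgradient_of_minimizer[OF assms(1,3), where C = "1 / (2 * \<gamma>)"])
       (simp only: proximal_term_expansion order_refl)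
  then have w: "subgradient g w ((1 / \<gamma>) *\<^sub>R (u - w))" by (simp add: algebra_simps)
  show ?thesis unfolding prox_eqI[OF assms(4) w] by (rule w)
qed

lemma subgradient_monotone:
  fixes h :: "'a::real_inner \<Rightarrow> ereal"
  assumes "subgradient h x s" "subgradient h y t"
  shows "0 \<le> (s - t) \<bullet> (x - y)"
proof -
  obtain a b where ab: "h x = ereal a" "h y = ereal b"
    using assms unfolding subgradient_def by (cases "h x"; cases "h y") auto
  then have "a + s \<bullet> (y - x) \<le> b" "b + t \<bullet> (x - y) \<le> a"
    using assms unfolding subgradient_def
    by (metis plus_ereal.simps(1) ereal_less_eq(3))+
  then show ?thesis by (simp add: algebra_simps)
qed

text \<open>
  This is monotonicity of the subgradients \<open>(u - prox u) / \<gamma>\<close> and \<open>(v - prox v) / \<gamma>\<close>. The subgradient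
  at \<open>x0\<close> only guarantees that both proximal points exist.
\<close>

lemma prox_firmly_nonexpansive:
  fixes g :: "'a::euclidean_space \<Rightarrow> ereal"
  assumes "proper_fun g" "closed_fun g" "convex_fun g" "\<gamma> > 0"
    and "subgradient g x0 s"
  shows "(prox \<gamma> g u - prox \<gamma> g v) \<bullet> (prox \<gamma> g u - prox \<gamma> g v) \<le>
    (prox \<gamma> g u - prox \<gamma> g v) \<bullet> (u - v)"
proof -
  let ?p = "prox \<gamma> g u" and ?r = "prox \<gamma> g v"
  have "0 \<le> ((1 / \<gamma>) *\<^sub>R (u - ?p) - (1 / \<gamma>) *\<^sub>R (v - ?r)) \<bullet> (?p - ?r)"
    by (rule subgradient_monotone; rule subgradient_prox[OF assms])
  also have "\<dots> = (1 / \<gamma>) * ((?p - ?r) \<bullet> (u - v) - (?p - ?r) \<bullet> (?p - ?r))"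
    by (simp add: inner_simps inner_commute algebra_simps)
  finally show ?thesis using assms(4) by (simp add: zero_le_divide_iff zero_le_mult_iff)
qed

section \<open>Contraction in the norm of the reflected resolvent\<close>

text \<open>
  The operator inequality \<open>M\<^sup>2 \<le> X M\<close>, a consequence of \<open>0 \<le> M \<le> X\<close>. It follows from the
  Cauchy--Schwarz inequality for the form of \<open>M\<close>, applied to \<open>M \<delta>\<close> and \<open>\<delta>\<close>.
\<close>

lemma pos_semidef_square_bound:
  fixes M :: "real^'n^'n"
  assumes "symmetric_matrix M" "pos_semidef M"
    and bound: "\<And>v. v \<bullet> (M *v v) \<le> X * (v \<bullet> v)"
  shows "(M *v \<delta>) \<bullet> (M *v \<delta>) \<le> X * (\<delta> \<bullet> (M *v \<delta>))"
proof (cases "M *v \<delta> = 0")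
  case False
  let ?n = "(M *v \<delta>) \<bullet> (M *v \<delta>)"
  have "?n * ?n \<le> ((M *v \<delta>) \<bullet> (M *v (M *v \<delta>))) * (\<delta> \<bullet> (M *v \<delta>))"
    using pos_semidef_Cauchy_Schwarz[OF assms(1,2), of "M *v \<delta>" \<delta>] by (simp add: power2_eq_square)
  also have "\<dots> \<le> (X * ?n) * (\<delta> \<bullet> (M *v \<delta>))"
    using assms(2) by (intro mult_right_mono bound) (simp add: pos_semidef_def)
  finally have "?n * ?n \<le> ?n * (X * (\<delta> \<bullet> (M *v \<delta>)))" by (simp add: algebra_simps)
  then show ?thesis using False by simp
qed simp

text \<open>
  The decrease of the \<open>M\<close>-norm in one step. In applications \<open>\<delta>\<close> is the difference of two points \<open>x\<close>,
  \<open>d\<close> the difference of their points \<open>z\<close>, and \<open>T\<close> the difference of their steps \<open>y - z\<close>. Setting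
  \<open>r = \<delta> / 2 - T\<close>, firm nonexpansiveness bounds the \<open>M\<close>-norm of \<open>r\<close> by \<open>X / 2\<close> times that of \<open>\<delta>\<close>.
  This single bound yields both the gradient inequality with the extreme constants \<open>(1 \<plusminus> X) / 2\<close> and,
  by Cauchy--Schwarz, the two-sided estimate of \<open>T \<bullet> M \<delta>\<close> with which these constants can be relaxed to
  \<open>a\<close> and \<open>b\<close>.
\<close>

lemma DR_step_contraction:
  fixes M :: "real^'n^'n"
  assumes sym: "symmetric_matrix M" and psd: "pos_semidef M"
    and "0 \<le> X" and bound: "\<And>v. v \<bullet> (M *v v) \<le> X * (v \<bullet> v)"
    and firm: "d \<bullet> d \<le> d \<bullet> (M *v \<delta>)"
    and T: "T = (1 / 2) *\<^sub>R (\<delta> + M *v \<delta>) - d"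
    and a: "a \<le> (1 - X) / 2" and b: "(1 + X) / 2 \<le> b" and ab: "0 < a + b"
    and lam: "0 \<le> lam" "lam \<le> 2 / (b + a)"
  shows "(\<delta> - lam *\<^sub>R T) \<bullet> (M *v (\<delta> - lam *\<^sub>R T)) \<le>
    (1 - 2 * lam * a * b / (a + b)) * (\<delta> \<bullet> (M *v \<delta>))"
proof -
  define r where "r = d - (1 / 2) *\<^sub>R (M *v \<delta>)"
  define x y z where "x = T \<bullet> (M *v \<delta>)" and "y = \<delta> \<bullet> (M *v \<delta>)" and "z = T \<bullet> (M *v T)"
  have T_r: "T = (1 / 2) *\<^sub>R \<delta> - r" unfolding T r_def by (simp add: algebra_simps)
  have swap: "\<delta> \<bullet> (M *v T) = x"
    unfolding x_def using symmetric_matrix_inner[OF sym, of \<delta> T] by (simp add: inner_commute)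
  have y: "0 \<le> y" and z: "0 \<le> z" using psd unfolding y_def z_def pos_semidef_def by auto

  \<comment> \<open>Completing the square in the firm nonexpansiveness of \<open>d\<close>.\<close>
  have "r \<bullet> r = d \<bullet> d - d \<bullet> (M *v \<delta>) + (1 / 4) * ((M *v \<delta>) \<bullet> (M *v \<delta>))"
    unfolding r_def by (simp add: inner_diff_left inner_diff_right inner_commute)
  then have "r \<bullet> r \<le> (1 / 4) * (X * y)"
    using firm pos_semidef_square_bound[OF sym psd bound, of \<delta>] unfolding y_def by linarith
  then have "X * (r \<bullet> r) \<le> X * ((1 / 4) * (X * y))" using \<open>0 \<le> X\<close> by (rule mult_left_mono)
  then have r: "r \<bullet> (M *v r) \<le> X\<^sup>2 / 4 * y"
    using bound[of r] by (simp add: power2_eq_square)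
  have r_eq: "r = (1 / 2) *\<^sub>R \<delta> - T" using T_r by simp
  have "r \<bullet> (M *v r) = z - x + y / 4"
    unfolding r_eq x_def y_def z_def using swap[unfolded x_def]
    by (simp add: matrix_vector_mult_diff_distrib matrix_vector_mult_scaleR inner_diff_left inner_diff_right
        field_simps)
  moreover have "(1 - X\<^sup>2) / 4 * y = y / 4 - X\<^sup>2 / 4 * y"
    by (simp add: left_diff_distrib diff_divide_distrib)
  ultimately have z_le: "z \<le> x - (1 - X\<^sup>2) / 4 * y" using r by linarith

  have "(r \<bullet> (M *v \<delta>))\<^sup>2 \<le> (X\<^sup>2 / 4 * y) * y"
    using pos_semidef_Cauchy_Schwarz[OF sym psd, of r \<delta>] mult_right_mono[OF r y]
    unfolding y_def by linarith
  also have "\<dots> = (X / 2 * y)\<^sup>2" by (simp add: power2_eq_square)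
  finally have "\<bar>r \<bullet> (M *v \<delta>)\<bar> \<le> X / 2 * y"
    by (rule abs_le_square_iff[THEN iffD2, THEN order_trans]) (use \<open>0 \<le> X\<close> y in simp)
  moreover have "r \<bullet> (M *v \<delta>) = y / 2 - x"
    unfolding r_eq x_def y_def by (simp add: inner_diff_left)
  ultimately have x_lower: "(1 - X) / 2 * y \<le> x" and x_upper: "x \<le> (1 + X) / 2 * y"
    by (auto simp: field_simps abs_le_iff)

  \<comment> \<open>The slack between the gradient inequalities with constants \<open>(a, b)\<close> and \<open>((1 - X) / 2, (1 + X) / 2)\<close>
    factors into these two products.\<close>
  have "0 \<le> (b - (1 + X) / 2) * (x - a * y) + ((1 - X) / 2 - a) * ((1 + X) / 2 * y - x)"
  proof (intro add_nonneg_nonneg mult_nonneg_nonneg)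
    show "0 \<le> x - a * y" using mult_right_mono[OF a y] x_lower by linarith
  qed (use a b x_upper in auto)
  also have "\<dots> = (a + b) * x - a * b * y - (x - (1 - X\<^sup>2) / 4 * y)"
    by (simp add: field_simps power2_eq_square)
  finally have z_ab: "z \<le> (a + b) * x - a * b * y" using z_le by linarith

  \<comment> \<open>The step size restriction makes the quadratic term in \<open>lam\<close> absorbable by the gradient inequality.\<close>
  have "lam * (a + b) \<le> 2" using lam(2) ab by (simp add: field_simps)
  then have "(lam * (a + b)) * (lam * z) \<le> 2 * (lam * z)"
    using lam(1) z by (intro mult_right_mono mult_nonneg_nonneg)
  also have "\<dots> \<le> 2 * (lam * ((a + b) * x - a * b * y))"
    using z_ab lam(1) by (intro mult_left_mono) auto
  finally have "(a + b) * (y - 2 * lam * x + lam\<^sup>2 * z) \<le> (a + b) * y - 2 * lam * a * b * y"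
    by (simp add: algebra_simps power2_eq_square)
  then have "y - 2 * lam * x + lam\<^sup>2 * z \<le> ((a + b) * y - 2 * lam * a * b * y) / (a + b)"
    using ab by (simp add: pos_le_divide_eq mult.commute)
  also have "\<dots> = (1 - 2 * lam * a * b / (a + b)) * y"
    using ab by (simp add: field_simps)
  also have "y - 2 * lam * x + lam\<^sup>2 * z = (\<delta> - lam *\<^sub>R T) \<bullet> (M *v (\<delta> - lam *\<^sub>R T))"
    using swap unfolding x_def y_def z_def
    by (simp add: matrix_vector_mult_diff_distrib matrix_vector_mult_scaleR inner_diff_left
        inner_diff_right power2_eq_square algebra_simps)
  finally show ?thesis unfolding y_def .
qed

section \<open>Spectrum of the reflected resolvent\<close>

text \<open>
  The linear part of the reflected proximal map \<open>x \<mapsto> 2 prox\<^sub>\<gamma>\<^sub>f(x) - x\<close> of the quadratic function, equal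
  to \<open>\<gamma> D\<^sup>-\<^sup>1\<close>.
\<close>

definition reflection_matrix :: "real \<Rightarrow> real^'n^'n \<Rightarrow> real^'n^'n" where
  "reflection_matrix \<gamma> Q = 2 *\<^sub>R matrix_inv (mat 1 + \<gamma> *\<^sub>R Q) - mat 1"

lemma invertible_resolvent:
  fixes Q :: "real^'n^'n"
  assumes "symmetric_matrix Q" "0 < lambda_min Q" "0 < \<gamma>"
  shows "invertible (mat 1 + \<gamma> *\<^sub>R Q)"
proof -
  have "mat 1 + \<gamma> *\<^sub>R Q = \<gamma> *\<^sub>R Q + 1 *\<^sub>R mat 1" by (simp add: add.commute)
  moreover have "0 \<notin> (\<lambda>s. \<gamma> * s + 1) ` eigenvalues Q"
  proof
    assume "0 \<in> (\<lambda>s. \<gamma> * s + 1) ` eigenvalues Q"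
    then obtain s where s: "s \<in> eigenvalues Q" "\<gamma> * s + 1 = 0" by auto
    have "0 < \<gamma> * s" using eigenvalue_bounds(1)[OF assms(1) s(1)] assms(2,3) by simp
    then show False using s(2) by linarith
  qed
  ultimately show ?thesis
    unfolding invertible_iff_eigenvalues
    using eigenvalues_affine[OF less_imp_neq[OF assms(3), symmetric], of Q 1] by metis
qed

text \<open>
  The eigenvalues are the images of those of \<open>Q\<close> under the decreasing map
  \<open>s \<mapsto> (1 - \<gamma> s) / (1 + \<gamma> s)\<close>, so the extreme ones are exchanged. The condition \<open>\<gamma> \<lambda>\<^sub>m\<^sub>a\<^sub>x(Q) < 1\<close> keeps
  them positive, and \<open>\<lambda>\<^sub>m\<^sub>i\<^sub>n(Q) > 0\<close> keeps them below 1.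
\<close>

lemma spectrum_reflection_matrix:
  fixes Q :: "real^'n^'n"
  assumes sym: "symmetric_matrix Q" and pos: "0 < lambda_min Q"
    and \<gamma>: "0 < \<gamma>" "\<gamma> < 1 / lambda_max Q"
  shows symmetric_reflection_matrix: "symmetric_matrix (reflection_matrix \<gamma> Q)"
    and lambda_min_reflection_matrix:
      "lambda_min (reflection_matrix \<gamma> Q) = (1 - \<gamma> * lambda_max Q) / (1 + \<gamma> * lambda_max Q)"
    and lambda_max_reflection_matrix:
      "lambda_max (reflection_matrix \<gamma> Q) = (1 - \<gamma> * lambda_min Q) / (1 + \<gamma> * lambda_min Q)"
    and lambda_min_reflection_matrix_pos: "0 < lambda_min (reflection_matrix \<gamma> Q)"
    and lambda_max_reflection_matrix_less: "lambda_max (reflection_matrix \<gamma> Q) < 1"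
proof -
  let ?M = "reflection_matrix \<gamma> Q"
  define m where "m s = 2 * inverse (\<gamma> * s + 1) + - 1" for s
  have range: "0 < \<gamma> * s" if "lambda_min Q \<le> s" for s
    using that \<gamma>(1) pos by simp
  have res: "mat 1 + \<gamma> *\<^sub>R Q = \<gamma> *\<^sub>R Q + 1 *\<^sub>R mat 1" by (simp add: add.commute)
  have M: "?M = 2 *\<^sub>R matrix_inv (mat 1 + \<gamma> *\<^sub>R Q) + (- 1) *\<^sub>R mat 1"
    unfolding reflection_matrix_def by simp
  show "symmetric_matrix ?M"
    unfolding M
    using symmetric_matrix_inv[OF _ invertible_resolvent[OF sym pos \<gamma>(1)]]
      symmetric_matrix_affine[OF sym, of \<gamma> 1]
    by (intro symmetric_matrix_affine) (simp only: res)
  have eig: "eigenvalues ?M = m ` eigenvalues Q"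
  proof -
    have "eigenvalues ?M = (\<lambda>e. 2 * e + - 1) ` eigenvalues (matrix_inv (mat 1 + \<gamma> *\<^sub>R Q))"
      unfolding M by (rule eigenvalues_affine) simp
    also have "\<dots> = (\<lambda>e. 2 * e + - 1) ` inverse ` eigenvalues (mat 1 + \<gamma> *\<^sub>R Q)"
      by (simp only: eigenvalues_matrix_inv[OF invertible_resolvent[OF sym pos \<gamma>(1)]])
    also have "eigenvalues (mat 1 + \<gamma> *\<^sub>R Q) = (\<lambda>s. \<gamma> * s + 1) ` eigenvalues Q"
      unfolding res using \<gamma>(1) by (intro eigenvalues_affine) simp
    finally have "eigenvalues ?M = (\<lambda>e. 2 * e + - 1) ` inverse ` (\<lambda>s. \<gamma> * s + 1) ` eigenvalues Q" .
    then show ?thesis by (simp add: image_image m_def)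
  qed
  have "m t \<le> m s" if "s \<in> eigenvalues Q" "t \<in> eigenvalues Q" "s \<le> t" for s t
  proof -
    have "0 < \<gamma> * s" using range eigenvalue_bounds(1)[OF sym that(1)] by simp
    then show ?thesis unfolding m_def using that(3) \<gamma>(1) by (simp add: le_imp_inverse_le)
  qed
  then have ext: "lambda_min ?M = m (lambda_max Q)" "lambda_max ?M = m (lambda_min Q)"
    using lambda_antimono[OF sym eig] by auto
  have m: "m s = (1 - \<gamma> * s) / (1 + \<gamma> * s)" if "lambda_min Q \<le> s" for s
    using range[OF that] unfolding m_def by (simp add: field_simps)
  show min: "lambda_min ?M = (1 - \<gamma> * lambda_max Q) / (1 + \<gamma> * lambda_max Q)"
    and max: "lambda_max ?M = (1 - \<gamma> * lambda_min Q) / (1 + \<gamma> * lambda_min Q)"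
    using ext m lambda_min_le_max[OF sym] by auto
  have "0 < lambda_max Q" using pos lambda_min_le_max[OF sym] by linarith
  then have "\<gamma> * lambda_max Q < 1" using \<gamma>(2) by (simp add: field_simps)
  then show "0 < lambda_min ?M"
    unfolding min using range[OF lambda_min_le_max[OF sym]] by simp
  show "lambda_max ?M < 1" unfolding max using range[OF order_refl] by simp
qed

lemma lambda_DR_D:
  fixes Q :: "real^'n^'n"
  assumes sym: "symmetric_matrix Q" and pos: "0 < lambda_min Q"
    and \<gamma>: "0 < \<gamma>" "\<gamma> < 1 / lambda_max Q"
  shows lambda_min_DR_D: "lambda_min (DR_D \<gamma> Q) = \<gamma> / lambda_max (reflection_matrix \<gamma> Q)"
    and lambda_max_DR_D: "lambda_max (DR_D \<gamma> Q) = \<gamma> / lambda_min (reflection_matrix \<gamma> Q)"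
proof -
  let ?M = "reflection_matrix \<gamma> Q"
  note symM = symmetric_reflection_matrix[OF assms] and posM = lambda_min_reflection_matrix_pos[OF assms]
  have range: "0 < e" if "e \<in> eigenvalues ?M" for e
    using posM eigenvalue_bounds(1)[OF symM that] by linarith
  then have inv: "invertible ?M" unfolding invertible_iff_eigenvalues by blast
  have D: "DR_D \<gamma> Q = \<gamma> *\<^sub>R matrix_inv ?M + 0 *\<^sub>R mat 1"
    unfolding DR_D_def reflection_matrix_def by simp
  have "eigenvalues (DR_D \<gamma> Q) = (\<lambda>e. \<gamma> / e) ` eigenvalues ?M"
    unfolding D using \<gamma>(1)
    by (subst eigenvalues_affine)
       (auto simp: eigenvalues_matrix_inv[OF inv] image_image divide_inverse)
  moreover have "\<gamma> / t \<le> \<gamma> / s" if "s \<in> eigenvalues ?M" "t \<in> eigenvalues ?M" "s \<le> t" for s t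
    using range[OF that(1)] that(3) \<gamma>(1) by (simp add: divide_left_mono)
  ultimately show "lambda_min (DR_D \<gamma> Q) = \<gamma> / lambda_max ?M"
    and "lambda_max (DR_D \<gamma> Q) = \<gamma> / lambda_min ?M"
    using lambda_antimono[OF symM, of "DR_D \<gamma> Q" "\<lambda>e. \<gamma> / e"] by auto
qed

text \<open>
  With \<open>X = \<lambda>\<^sub>m\<^sub>a\<^sub>x(M)\<close>, the first entry of the minimum in \<open>\<mu>\<^sub>h\<close>, multiplied by \<open>\<lambda>\<^sub>m\<^sub>i\<^sub>n(D) = \<gamma> / X\<close>, equals
  \<open>(1 - X) / 2\<close> exactly. The bound on \<open>L\<^sub>h\<close> is generous: \<open>L\<^sub>h\<close> is at least 1, while \<open>(1 + X) / 2\<close> is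
  less than 1.
\<close>

lemma DR_constants_bounds:
  fixes Q :: "real^'n^'n"
  assumes sym: "symmetric_matrix Q" and pos: "0 < lambda_min Q"
    and \<gamma>: "0 < \<gamma>" "\<gamma> < 1 / lambda_max Q"
  shows DR_mu_nonneg: "0 \<le> DR_mu \<gamma> Q"
    and DR_mu_le: "DR_mu \<gamma> Q \<le> (1 - lambda_max (reflection_matrix \<gamma> Q)) / 2"
    and DR_L_ge: "(1 + lambda_max (reflection_matrix \<gamma> Q)) / 2 \<le> DR_L \<gamma> Q"
proof -
  let ?M = "reflection_matrix \<gamma> Q"
  define \<mu> L X where "\<mu> = lambda_min Q" and "L = lambda_max Q" and "X = lambda_max ?M"
  have \<mu>L: "0 < \<mu>" "\<mu> \<le> L" using pos lambda_min_le_max[OF sym] by (auto simp: \<mu>_def L_def)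
  then have \<gamma>L: "\<gamma> * L < 1" "0 < \<gamma> * L" "0 < \<gamma> * \<mu>"
    using \<gamma> by (auto simp: L_def[symmetric] field_simps)
  have "\<gamma> * \<mu> \<le> \<gamma> * L" using \<mu>L \<gamma>(1) by simp
  then have \<gamma>\<mu>: "\<gamma> * \<mu> < 1" using \<gamma>L by linarith
  have X: "X = (1 - \<gamma> * \<mu>) / (1 + \<gamma> * \<mu>)"
    unfolding X_def \<mu>_def by (rule lambda_max_reflection_matrix[OF assms])
  have Xpos: "0 < X" unfolding X using \<gamma>L \<gamma>\<mu> by simp
  define c1 c2 where "c1 = (1 - \<gamma> * \<mu>) * \<mu> / (1 + \<gamma> * \<mu>)\<^sup>2" and "c2 = (1 - \<gamma> * L) * L / (1 + \<gamma> * L)\<^sup>2"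
  have mu: "DR_mu \<gamma> Q = \<gamma> / X * min c1 c2"
    unfolding DR_mu_def Let_def lambda_min_DR_D[OF assms] X_def c1_def c2_def \<mu>_def L_def ..
  have c: "0 \<le> c1" "0 \<le> c2" unfolding c1_def c2_def using \<mu>L \<gamma>L \<gamma>\<mu> by auto
  then show "0 \<le> DR_mu \<gamma> Q" unfolding mu using \<gamma>(1) Xpos by simp
  have "DR_mu \<gamma> Q \<le> \<gamma> / X * c1"
    unfolding mu using \<gamma>(1) Xpos by (intro mult_left_mono) auto
  also have "\<dots> = (1 - X) / 2"
  proof -
    have "\<gamma> * c1 = X * (\<gamma> * \<mu> / (1 + \<gamma> * \<mu>))"
      unfolding c1_def X by (simp add: power2_eq_square)
    then have "\<gamma> / X * c1 = \<gamma> * \<mu> / (1 + \<gamma> * \<mu>)" 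
      using Xpos by (simp add: nonzero_divide_eq_eq eq_divide_eq mult.commute)
    also have "\<dots> = (1 - X) / 2" unfolding X using \<gamma>L(3) by (simp add: field_simps)
    finally show ?thesis .
  qed
  finally show "DR_mu \<gamma> Q \<le> (1 - lambda_max ?M) / 2" unfolding X_def .
  have "1 \<le> DR_L \<gamma> Q" unfolding DR_L_def Let_def L_def[symmetric] using \<gamma>L by (simp add: field_simps)
  then show "(1 + lambda_max ?M) / 2 \<le> DR_L \<gamma> Q"
    using lambda_max_reflection_matrix_less[OF assms] by (simp add: field_simps)
qed

section \<open>The proximal map of a quadratic function\<close>

lemma quad_expansion:
  fixes Q :: "real^'n^'n"
  assumes "symmetric_matrix Q"
  shows "1 / 2 * ((x + v) \<bullet> (Q *v (x + v))) + q \<bullet> (x + v) =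
    (1 / 2 * (x \<bullet> (Q *v x)) + q \<bullet> x) + (Q *v x + q) \<bullet> v + 1 / 2 * (v \<bullet> (Q *v v))"
proof -
  have "x \<bullet> (Q *v v) = (Q *v x) \<bullet> v" by (rule symmetric_matrix_inner[OF assms])
  moreover have "v \<bullet> (Q *v x) = (Q *v x) \<bullet> v" by (rule inner_commute)
  ultimately show ?thesis
    by (simp add: matrix_vector_right_distrib inner_add_left inner_add_right algebra_simps)
qed

lemma prox_quad_fun:
  fixes Q :: "real^'n^'n"
  assumes "symmetric_matrix Q" "pos_semidef Q" "0 < \<gamma>"
    and w: "w + \<gamma> *\<^sub>R (Q *v w) = u - \<gamma> *\<^sub>R q"
  shows "prox \<gamma> (quad_fun Q q) u = w"
proof (rule prox_eqI[OF assms(3)])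
  have "subgradient (quad_fun Q q) w (Q *v w + q)"
  proof -
    have "1 / 2 * (w \<bullet> (Q *v w)) + q \<bullet> w + (Q *v w + q) \<bullet> (v - w) \<le>
      1 / 2 * (v \<bullet> (Q *v v)) + q \<bullet> v" for v
    proof -
      have "0 \<le> 1 / 2 * ((v - w) \<bullet> (Q *v (v - w)))" using assms(2) unfolding pos_semidef_def by simp
      then show ?thesis
        using quad_expansion[OF assms(1), of w "v - w" q] unfolding add.commute[of w "v - w"] diff_add_cancel
        by linarith
    qed
    then show ?thesis unfolding subgradient_def quad_fun_def by simp
  qed
  moreover have "u - w = \<gamma> *\<^sub>R (Q *v w + q)" using w by (simp add: algebra_simps)
  ultimately show "subgradient (quad_fun Q q) w ((1 / \<gamma>) *\<^sub>R (u - w))"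
    using assms(3) by simp
qed

lemma resolvent_nonexpansive:
  fixes Q :: "real^'n^'n"
  assumes "pos_semidef Q" "0 < \<gamma>" "w + \<gamma> *\<^sub>R (Q *v w) = \<delta>"
  shows "w \<bullet> w \<le> \<delta> \<bullet> \<delta>"
proof -
  have "0 \<le> \<gamma> * (w \<bullet> (Q *v w))" using assms(1,2) unfolding pos_semidef_def by simp
  moreover have "\<delta> \<bullet> \<delta> = w \<bullet> w + 2 * (\<gamma> * (w \<bullet> (Q *v w))) + (\<gamma> *\<^sub>R (Q *v w)) \<bullet> (\<gamma> *\<^sub>R (Q *v w))"
    unfolding assms(3)[symmetric] by (simp add: inner_add_left inner_add_right inner_commute)
  ultimately show ?thesis using inner_ge_zero[of "\<gamma> *\<^sub>R (Q *v w)"] by linarith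
qed

section \<open>Linear convergence\<close>

text \<open>
  Needed to iterate the one-step estimate: by the step size restriction the subtracted term is at most
  \<open>4 a b / (a + b)\<^sup>2\<close>, which does not exceed 1 by the inequality of arithmetic and geometric means.
\<close>

lemma contraction_rate_nonneg:
  fixes a b lam :: real
  assumes "0 \<le> a" "0 < b" "0 \<le> lam" "lam \<le> 2 / (b + a)"
  shows "0 \<le> 1 - 2 * lam * a * b / (a + b)"
proof -
  have "lam * (a + b) \<le> 2" using assms by (simp add: field_simps)
  then have "(lam * (a + b)) * (2 * a * b) \<le> 2 * (2 * a * b)"
    using assms by (intro mult_right_mono) auto
  also have "\<dots> \<le> (a + b) * (a + b)"
    using zero_le_power2[of "a - b"] by (simp add: power2_eq_square algebra_simps)
  finally have "(a + b) * (2 * lam * a * b) \<le> (a + b) * (a + b)" by (simp add: algebra_simps)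
  then have "2 * lam * a * b \<le> a + b" using assms by simp
  then show ?thesis using assms by (simp add: field_simps)
qed

theorem theorem4:
  fixes Q :: "real^'n^'n" and q :: "real^'n" and g :: "real^'n \<Rightarrow> ereal"
    and \<gamma> lam :: real
    and x y z :: "nat \<Rightarrow> real^'n"
    and xt xs :: "real^'n"
  defines "f \<equiv> quad_fun Q q"
    and "\<mu>\<^sub>h \<equiv> DR_mu \<gamma> Q"
    and "L\<^sub>h \<equiv> DR_L \<gamma> Q"
    and "D \<equiv> DR_D \<gamma> Q"
  assumes "symmetric_matrix Q" and "pos_semidef Q"
    and "proper_fun g" and "closed_fun g" and "convex_fun g"
    and "minimizers (\<lambda>v. f v + g v) \<noteq> {}"
    and "lambda_min Q > 0"
    and "0 < \<gamma>" and "\<gamma> < 1 / lambda_max Q"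
    and "0 < lam" and "lam \<le> 2 / (L\<^sub>h + \<mu>\<^sub>h)"
    and "DR_iteration \<gamma> (\<lambda>_. lam) f g x y z"
    and "xt \<in> DR_fixed \<gamma> f g"
    and "xs = prox \<gamma> f xt"
  shows "minimizers (\<lambda>v. f v + g v) = {xs} \<and>
    (\<forall>k. (norm (y k - xs))\<^sup>2 \<le>
       lambda_max D / lambda_min D *
       (1 - 2 * lam * \<mu>\<^sub>h * L\<^sub>h / (\<mu>\<^sub>h + L\<^sub>h)) ^ k * (norm (x 0 - xt))\<^sup>2)"
proof -
  note sym = \<open>symmetric_matrix Q\<close> and psd = \<open>pos_semidef Q\<close> and pos = \<open>lambda_min Q > 0\<close>
    and \<gamma> = \<open>0 < \<gamma>\<close> \<open>\<gamma> < 1 / lambda_max Q\<close>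
  note Q = sym pos \<gamma>
  note gclass = \<open>proper_fun g\<close> \<open>closed_fun g\<close> \<open>convex_fun g\<close>
  define \<phi> where "\<phi> v = 1 / 2 * (v \<bullet> (Q *v v)) + q \<bullet> v" for v
  have f_\<phi>: "f v = ereal (\<phi> v)" for v unfolding f_def quad_fun_def \<phi>_def ..
  note expand = quad_expansion[OF sym, of _ _ q, folded \<phi>_def]

  obtain x0 where "is_arg_min (\<lambda>v. ereal (\<phi> v) + g v) (\<lambda>_. True) x0"
    using \<open>minimizers _ \<noteq> {}\<close> unfolding minimizers_def f_\<phi> by auto
  then have sub0: "subgradient g x0 (- (Q *v x0 + q))"
    by (rule subgradient_of_minimizer[OF gclass(1,3), where C = "lambda_max Q / 2"])
       (use expand lambda_max_bound[OF sym] in simp)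

  define P where "P = matrix_inv (mat 1 + \<gamma> *\<^sub>R Q)"
  define M where "M = reflection_matrix \<gamma> Q"
  have P_resolvent: "P *v u + \<gamma> *\<^sub>R (Q *v (P *v u)) = u" for u
  proof -
    have "(mat 1 + \<gamma> *\<^sub>R Q) *v (P *v u) = u"
      unfolding P_def by (simp add: matrix_vector_mul_assoc matrix_inv_right[OF invertible_resolvent[OF sym pos \<gamma>(1)]])
    then show ?thesis by (simp add: matrix_vector_mult_add_rdistrib flip: scaleR_matrix_vector_assoc)
  qed
  have M_P: "M *v u = 2 *\<^sub>R (P *v u) - u" for u
    unfolding M_def reflection_matrix_def P_def
    by (simp add: matrix_vector_mult_diff_rdistrib flip: scaleR_matrix_vector_assoc)
  have prox_f: "prox \<gamma> f u = P *v (u - \<gamma> *\<^sub>R q)" for u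
    unfolding f_def by (rule prox_quad_fun[OF sym psd \<gamma>(1) P_resolvent])

  define X where "X = lambda_max M"
  note symM = symmetric_reflection_matrix[OF Q, folded M_def]
  note minM = lambda_min_reflection_matrix_pos[OF Q, folded M_def]
  have M_upper: "v \<bullet> (M *v v) \<le> X * (v \<bullet> v)" for v
    unfolding X_def by (rule lambda_max_bound[OF symM])
  have M_lower: "lambda_min M * (v \<bullet> v) \<le> v \<bullet> (M *v v)" for v
    by (rule lambda_min_bound[OF symM])
  have psdM: "pos_semidef M"
    unfolding pos_semidef_def using M_lower minM by (meson inner_ge_zero less_imp_le mult_nonneg_nonneg order_trans)
  have Xpos: "0 < X" using minM lambda_min_le_max[OF symM] unfolding X_def by linarith
  note ab = DR_mu_nonneg[OF Q, folded \<mu>\<^sub>h_def] DR_mu_le[OF Q, folded \<mu>\<^sub>h_def M_def X_def]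
    DR_L_ge[OF Q, folded L\<^sub>h_def M_def X_def]
  have Lpos: "0 < L\<^sub>h" using ab(3) Xpos by (simp add: field_simps)
  define \<rho> where "\<rho> = 1 - 2 * lam * \<mu>\<^sub>h * L\<^sub>h / (\<mu>\<^sub>h + L\<^sub>h)"
  have \<rho>: "0 \<le> \<rho>"
    unfolding \<rho>_def using ab(1) Lpos \<open>0 < lam\<close> \<open>lam \<le> _\<close> by (intro contraction_rate_nonneg) auto

  have xs: "prox \<gamma> g (2 *\<^sub>R xs - xt) = xs"
    using \<open>xt \<in> DR_fixed \<gamma> f g\<close> unfolding DR_fixed_def \<open>xs = prox \<gamma> f xt\<close> by simp
  have xs_P: "xs = P *v (xt - \<gamma> *\<^sub>R q)" unfolding \<open>xs = prox \<gamma> f xt\<close> by (rule prox_f)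

  \<comment> \<open>At the fixed point \<open>(x\<^sub>\<star> - xt) / \<gamma>\<close> is both a subgradient of \<open>g\<close> and the negative gradient of \<open>f\<close>.\<close>
  have "subgradient g xs (- (Q *v xs + q))"
  proof -
    have "xs - xt = \<gamma> *\<^sub>R (- (Q *v xs + q))"
      using P_resolvent[of "xt - \<gamma> *\<^sub>R q", folded xs_P] by (simp add: algebra_simps)
    then have "(1 / \<gamma>) *\<^sub>R (xs - xt) = - (Q *v xs + q)" using \<gamma>(1) by simp
    moreover have "2 *\<^sub>R xs - xt - xs = xs - xt" by (simp add: scaleR_2)
    ultimately show ?thesis
      using subgradient_prox[OF gclass \<gamma>(1) sub0, of "2 *\<^sub>R xs - xt", unfolded xs] by simp
  qed
  then have "is_arg_min (\<lambda>v. ereal (\<phi> v) + g v) (\<lambda>_. True) v \<longleftrightarrow> v = xs" for v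
    by (rule unique_minimizer_of_subgradient[where c = "lambda_min Q / 2"])
       (use expand lambda_min_bound[OF sym] pos in simp_all)
  then have "minimizers (\<lambda>v. f v + g v) = {xs}" unfolding minimizers_def f_\<phi> by auto

  moreover have "(norm (y k - xs))\<^sup>2 \<le> lambda_max D / lambda_min D * \<rho> ^ k * (norm (x 0 - xt))\<^sup>2" for k
  proof -
    define \<delta> where "\<delta> k = x k - xt" for k
    have it: "y k = P *v (x k - \<gamma> *\<^sub>R q)" "z k = prox \<gamma> g (2 *\<^sub>R y k - x k)"
      "x (Suc k) = x k + lam *\<^sub>R (z k - y k)" for k
      using \<open>DR_iteration _ _ _ _ _ _ _\<close> prox_f unfolding DR_iteration_def by auto
    have y_diff: "y k - xs = P *v \<delta> k" for k
      unfolding it xs_P \<delta>_def by (simp flip: matrix_vector_mult_diff_distrib)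
    have step: "\<delta> (Suc k) \<bullet> (M *v \<delta> (Suc k)) \<le> \<rho> * (\<delta> k \<bullet> (M *v \<delta> k))" for k
    proof -
      define d where "d = z k - xs"
      have d: "d = prox \<gamma> g (2 *\<^sub>R y k - x k) - prox \<gamma> g (2 *\<^sub>R xs - xt)"
        unfolding d_def it(2) xs ..
      \<comment> \<open>The arguments passed to \<open>prox\<^sub>\<gamma>\<^sub>g\<close> differ by the reflection of \<open>\<delta>\<close>.\<close>
      have refl: "(2 *\<^sub>R y k - x k) - (2 *\<^sub>R xs - xt) = M *v \<delta> k"
        unfolding M_P y_diff[symmetric] by (simp add: \<delta>_def algebra_simps)
      have firm: "d \<bullet> d \<le> d \<bullet> (M *v \<delta> k)"
        unfolding d refl[symmetric] by (rule prox_firmly_nonexpansive[OF gclass \<gamma>(1) sub0])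
      have "y k - z k = P *v \<delta> k - d" unfolding y_diff[symmetric] d_def by simp
      also have "\<dots> = (1 / 2) *\<^sub>R (\<delta> k + M *v \<delta> k) - d" unfolding M_P by simp
      finally have T: "y k - z k = (1 / 2) *\<^sub>R (\<delta> k + M *v \<delta> k) - d" .
      have "\<delta> (Suc k) = \<delta> k - lam *\<^sub>R (y k - z k)"
        unfolding \<delta>_def it(3) by (simp add: algebra_simps)
      then show ?thesis
        unfolding \<rho>_def
        using DR_step_contraction[OF symM psdM _ M_upper firm T ab(2,3), of lam]
          Xpos ab(1) Lpos \<open>0 < lam\<close> \<open>lam \<le> _\<close> by simp
    qed
    have V: "\<delta> k \<bullet> (M *v \<delta> k) \<le> \<rho> ^ k * (\<delta> 0 \<bullet> (M *v \<delta> 0))"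
    proof (induction k)
      case (Suc k)
      show ?case using step[of k] mult_left_mono[OF Suc.IH \<rho>] by simp
    qed simp
    have "lambda_min M * (norm (y k - xs))\<^sup>2 \<le> lambda_min M * (\<delta> k \<bullet> \<delta> k)"
      unfolding power2_norm_eq_inner y_diff
      using resolvent_nonexpansive[OF psd \<gamma>(1) P_resolvent] minM by simp
    also have "\<dots> \<le> \<delta> k \<bullet> (M *v \<delta> k)" by (rule M_lower)
    also note V
    also have "\<rho> ^ k * (\<delta> 0 \<bullet> (M *v \<delta> 0)) \<le> \<rho> ^ k * (X * (\<delta> 0 \<bullet> \<delta> 0))"
      using \<rho> by (intro mult_left_mono M_upper) simp
    finally have "(norm (y k - xs))\<^sup>2 \<le> X / lambda_min M * \<rho> ^ k * (norm (x 0 - xt))\<^sup>2"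
      using minM unfolding power2_norm_eq_inner \<delta>_def by (simp add: field_simps)
    moreover have "lambda_max D / lambda_min D = X / lambda_min M"
      unfolding D_def lambda_DR_D[OF Q] M_def[symmetric] X_def[symmetric] using \<gamma>(1) by simp
    ultimately show ?thesis by simp
  qed
  ultimately show ?thesis unfolding \<rho>_def by blast
qed

end
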